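(* Suppose that axioms (A1), (A2) and (A3) (stated in the context) are satisfied. Then there exists a unique substance $S$, and it is independent of time and contains $\mathcal{C}(e)$. That is, there is a substance $S$ with $$\mathcal{C}(e)\subseteq S\subseteq\bigcap_{t\in\mathbb{R}}E_t,$$ and for every $t\in\mathbb{R}$, every substance $\Lambda\subseteq E_t$ equals $S$.
   Context: Time is modelled by $\mathbb{R}$. For each $t\in\mathbb{R}$, $E_t$ is a set (everything existing or having existed before time $t$), and $E_t\subseteq E_{t'}$ whenever $t\le t'$. $\mathcal{P}(E_t)$ is the power set of $E_t$, ordered by inclusion. The law of causality is a time-independent rule $\mathcal{C}$ assigning to every $A\in\bigcup_{t\in\mathbb{R}}\mathcal{P}(E_t)$ a set $\mathcal{C}(A)$ (the cause of $A$), not depending on $t$, with $\mathcal{C}(A)\in\mathcal{P}(E_t)$ whenever $A\in\mathcal{P}(E_t)$. Axiom (A1): for every $t\in\mathbb{R}$, $\mathcal{C}$ restricts to a map $\mathcal{P}(E_t)\to\mathcal{P}(E_t)\setminus\{\emptyset\}$ (every cause is nonempty). Axiom (A2): for every $t\in\mathbb{R}$ and all $A,B\in\mathcal{P}(E_t)$, if $A\subseteq B$ then $\mathcal{C}(A)\subseteq\mathcal{C}(B)$. A substance is a set $S\subseteq E_t$, for some $t\in\mathbb{R}$, such that $\mathcal{C}(S)=S$. Axiom (A3): two different substances have nothing in common, i.e. if $S,S'$ are substances and $S\neq S'$ then $S\cap S'=\emptyset$. The set $e$ is $e:=\bigcap_{t\in\mathbb{R}}\bigcap_{A\subseteq E_t}A=\emptyset$.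 *)

theory Defs
  imports Complex_Main
begin

text \<open>
  The sets of existing things are subsets of an arbitrary ambient type. The law of
  causality is a total function on subsets of that type, but its values matter only on
  subsets of some \<open>E t\<close>: every condition below is restricted to such sets.
\<close>

definition causal_world :: "(real \<Rightarrow> 'a set) \<Rightarrow> ('a set \<Rightarrow> 'a set) \<Rightarrow> bool" where
  "causal_world E C \<longleftrightarrow>
     (\<forall>t t'. t \<le> t' \<longrightarrow> E t \<subseteq> E t') \<and>
     (\<forall>t. \<forall>A \<in> Pow (E t). C A \<in> Pow (E t))"

definition axiom_A1 :: "(real \<Rightarrow> 'a set) \<Rightarrow> ('a set \<Rightarrow> 'a set) \<Rightarrow> bool" where
  "axiom_A1 E C \<longleftrightarrow> (\<forall>t. \<forall>A \<in> Pow (E t). C A \<in> Pow (E t) - {{}})"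

definition axiom_A2 :: "(real \<Rightarrow> 'a set) \<Rightarrow> ('a set \<Rightarrow> 'a set) \<Rightarrow> bool" where
  "axiom_A2 E C \<longleftrightarrow>
     (\<forall>t. \<forall>A \<in> Pow (E t). \<forall>B \<in> Pow (E t). A \<subseteq> B \<longrightarrow> C A \<subseteq> C B)"

definition substance :: "(real \<Rightarrow> 'a set) \<Rightarrow> ('a set \<Rightarrow> 'a set) \<Rightarrow> 'a set \<Rightarrow> bool" where
  "substance E C S \<longleftrightarrow> (\<exists>t. S \<subseteq> E t) \<and> C S = S"

definition axiom_A3 :: "(real \<Rightarrow> 'a set) \<Rightarrow> ('a set \<Rightarrow> 'a set) \<Rightarrow> bool" where
  "axiom_A3 E C \<longleftrightarrow>
     (\<forall>S S'. substance E C S \<and> substance E C S' \<and> S \<noteq> S' \<longrightarrow> S \<inter> S' = {})"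

definition e_set :: "(real \<Rightarrow> 'a set) \<Rightarrow> 'a set" where
  "e_set E = (\<Inter>t. \<Inter>A \<in> Pow (E t). A)"

lemma e_set_eq_empty: "e_set E = {}"
  by (auto simp: e_set_def)

end

theory Submission
  imports Defs
begin

text \<open>
  Monotonicity of the law of causality lets the Knaster--Tarski theorem be applied to each
  complete lattice \<open>Pow (E t)\<close>, so every time has a substance (\<open>substance_at_time\<close>). The cause
  of the empty set lies in every substance \<open>\<Lambda>\<close>, because
  \<open>C {} \<subseteq> C \<Lambda> = \<Lambda>\<close> (\<open>cause_of_empty_subset_substance\<close>). As that cause is nonempty, any two
  substances meet, and then disjointness of distinct substances makes them equal
  (\<open>substance_unique\<close>). In particular the substances found at different times coincide, so
  the common one is contained in every \<open>E t\<close>.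
\<close>

text \<open>
  Composing with intersection by \<open>E t\<close> extends the restriction of \<open>C\<close> to a map that is
  monotone on all sets and has all its values in \<open>Pow (E t)\<close>. A fixed point of the extension
  is therefore a subset of \<open>E t\<close>, where the extension agrees with \<open>C\<close>.
\<close>

lemma substance_at_time:
  assumes "causal_world E C" and "axiom_A2 E C"
  obtains S where "substance E C S" and "S \<subseteq> E t"
proof -
  define F where "F A = C (A \<inter> E t)" for A
  have "mono F"
  proof (rule monoI)
    fix A B :: "'a set"
    assume "A \<subseteq> B"
    then have "A \<inter> E t \<subseteq> B \<inter> E t" by blast
    then show "F A \<subseteq> F B"
      using assms(2) unfolding axiom_A2_def F_def by blast
  qed
  then have fixed: "F (lfp F) = lfp F"
    by (rule lfp_fixpoint)
  have "F (lfp F) \<subseteq> E t"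
    using assms(1) unfolding causal_world_def F_def by blast
  with fixed have sub: "lfp F \<subseteq> E t" by simp
  then have "lfp F \<inter> E t = lfp F" by blast
  with fixed have "C (lfp F) = lfp F" by (simp add: F_def)
  with sub have "substance E C (lfp F)" unfolding substance_def by blast
  then show thesis using sub by (rule that)
qed

lemma cause_of_empty_subset_substance:
  assumes "axiom_A2 E C" and "substance E C S"
  shows "C {} \<subseteq> S"
proof -
  obtain t where "S \<subseteq> E t" and fixed: "C S = S"
    using assms(2) unfolding substance_def by blast
  then have "C {} \<subseteq> C S"
    using assms(1) unfolding axiom_A2_def by blast
  with fixed show ?thesis by simp
qed

lemma substance_unique:
  assumes "axiom_A1 E C" and "axiom_A2 E C" and "axiom_A3 E C"
    and "substance E C S" and "substance E C S'"
  shows "S = S'"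
proof -
  have "C {} \<noteq> {}"
    using assms(1) unfolding axiom_A1_def by blast
  moreover have "C {} \<subseteq> S \<inter> S'"
    using assms(2,4,5) by (simp add: cause_of_empty_subset_substance)
  ultimately have "S \<inter> S' \<noteq> {}" by blast
  then show ?thesis
    using assms(3-5) unfolding axiom_A3_def by blast
qed

theorem proposition4:
  fixes E :: "real \<Rightarrow> 'a set" and C :: "'a set \<Rightarrow> 'a set"
  assumes "causal_world E C"
    and "axiom_A1 E C"
    and "axiom_A2 E C"
    and "axiom_A3 E C"
  shows "\<exists>S. substance E C S \<and> C (e_set E) \<subseteq> S \<and> S \<subseteq> (\<Inter>t. E t) \<and>
           (\<forall>t. \<forall>\<Lambda>. substance E C \<Lambda> \<and> \<Lambda> \<subseteq> E t \<longrightarrow> \<Lambda> = S)"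
proof -
  note unique = substance_unique[OF assms(2-4)]
  obtain S where S: "substance E C S"
    using substance_at_time[OF assms(1,3)] by blast
  have "S \<subseteq> E t" for t
  proof -
    obtain S' where "substance E C S'" and "S' \<subseteq> E t"
      using substance_at_time[OF assms(1,3)] by blast
    with unique[OF S] show ?thesis by blast
  qed
  then have "S \<subseteq> (\<Inter>t. E t)" by blast
  moreover have "C (e_set E) \<subseteq> S"
    using cause_of_empty_subset_substance[OF assms(3) S] by (simp add: e_set_eq_empty)
  ultimately show ?thesis using S unique by blast
qed

end
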